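(* Let $q\equiv 1\pmod 4$ be a prime power and let $0<\alpha<1$ be a constant. Then $$\left|\bigcup_{\alpha q/2<n<\alpha q}\Omega(n,q)\cup\tilde\Omega(n+1,q)\right|\geq 2^{(1+o(1))\left(H(\frac{\alpha}{2})-\alpha\right)q},$$ where $o(1)\to 0$ as $q\to\infty$ and $H(x)=-x\log_2x-(1-x)\log_2(1-x)$ is the binary entropy function.
   Context: Let $\eta$ be the quadratic character of $\mathbb{F}_q$ ($\eta(x)=1$ for nonzero squares, $-1$ for nonsquares). For a subset $\mathcal{S}=\{\alpha_1,\dots,\alpha_n\}\subseteq\mathbb{F}_q$, put $\Delta_{\mathcal{S}}(\alpha_i)=\prod_{j\neq i}(\alpha_i-\alpha_j)$. For even $n$, $\Omega(n,q)$ is the set of all $n$-element subsets $\mathcal{S}\subseteq\mathbb{F}_q$ such that the values $\eta(\Delta_{\mathcal{S}}(\alpha_i))$, $1\le i\le n$, are all equal (equivalently, there is $\boldsymbol v\in(\mathbb{F}_q^* )^n$ with the generalized Reed–Solomon code $GRS_{n/2}(\boldsymbol\alpha,\boldsymbol v)$ self-dual); for odd $n$, $\tilde\Omega(n+1,q)$ is the set of all $n$-element subsets $\mathcal{S}\subseteq\mathbb{F}_q$ with $\eta(-\Delta_{\mathcal{S}}(\alpha_i))=1$ for all $i$ (equivalently, some extended GRS code $GRS_{(n+1)/2}(\boldsymbol\alpha,\boldsymbol v,\infty)$ is self-dual). By convention $\Omega(n,q)=\emptyset$ for odd $n$ and $\tilde\Omega(n+1,q)=\emptyset$ for even $n$,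 so the union is a union of sets of subsets of $\mathbb{F}_q$. *)

theory Defs
  imports
    "HOL-Algebra.Ring"
    "HOL-Number_Theory.Cong"
    "HOL-Number_Theory.Prime_Powers"
    Complex_Main
begin

text \<open>
  An \<open>o(1)\<close> term depending only on \<open>q\<close> must be uniform over all finite fields of
  order \<open>q\<close>; hence fields are rendered as carrier-based rings, over which one can
  quantify inside a formula.
\<close>

definition quad_char :: "('a, 'b) ring_scheme \<Rightarrow> 'a \<Rightarrow> int" where
  "quad_char F x =
     (if x = \<zero>\<^bsub>F\<^esub> then 0
      else if \<exists>y\<in>carrier F. x = y \<otimes>\<^bsub>F\<^esub> y then 1
      else -1)"

definition Delta :: "('a, 'b) ring_scheme \<Rightarrow> 'a set \<Rightarrow> 'a \<Rightarrow> 'a" where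
  "Delta F S a = (\<Otimes>\<^bsub>F\<^esub>b\<in>S - {a}. a \<ominus>\<^bsub>F\<^esub> b)"

definition Omega :: "('a, 'b) ring_scheme \<Rightarrow> nat \<Rightarrow> 'a set set" where
  "Omega F n =
     {S. even n \<and> S \<subseteq> carrier F \<and> finite S \<and> card S = n \<and>
         (\<forall>a\<in>S. \<forall>b\<in>S. quad_char F (Delta F S a) = quad_char F (Delta F S b))}"

text \<open>
  The index is the length \<open>m = n + 1\<close> of the extended code; the members are sets of
  \<open>n = m - 1\<close> evaluation points, so \<open>n\<close> is odd exactly when \<open>m\<close> is even.
\<close>

definition Omega_ext :: "('a, 'b) ring_scheme \<Rightarrow> nat \<Rightarrow> 'a set set" where
  "Omega_ext F m =
     {S. even m \<and> S \<subseteq> carrier F \<and> finite S \<and> card S + 1 = m \<and>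
         (\<forall>a\<in>S. quad_char F (\<ominus>\<^bsub>F\<^esub> Delta F S a) = 1)}"

definition binary_entropy :: "real \<Rightarrow> real" where
  "binary_entropy x = - x * log 2 x - (1 - x) * log 2 (1 - x)"

end

theory Submission
  imports Defs "HOL-Algebra.Multiplicative_Group" "HOL-Real_Asymp.Real_Asymp"
begin

text \<open>
  Join two field elements when their difference is a nonsquare; as \<open>-1\<close> is a square, this is a graph
  (the complement of the Paley graph), and \<open>\<eta>(\<Delta>\<^sub>S(a)) = (-1)^d\<close> where \<open>d\<close> is the degree of \<open>a\<close> in the
  subgraph induced by \<open>S\<close>. So the union consists of the vertex sets whose induced subgraph has only even
  degrees, or has even order and only odd degrees. By Gallai's theorem every vertex set \<open>T\<close> can be
  partitioned into two sets inducing even degrees, and also into one with even and one with odd degrees.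

  Take \<open>T\<close> of odd size \<open>m\<close>, where \<open>m\<close> is \<open>\<lceil>\<alpha> q\<rceil>\<close> or \<open>\<lceil>\<alpha> q\<rceil> + 1\<close>. The larger part then has more than
  \<open>\<alpha> q / 2\<close> elements, and one of the two partitions has larger part of size at most \<open>m - 2 < \<alpha> q\<close>, unless all
  degrees in \<open>T\<close> are even or some two vertices have complementary neighbourhoods in the rest of \<open>T\<close>. As two
  vertices of the Paley graph agree on about half of the other vertices, such exceptional \<open>T\<close> are
  too rare to matter. With \<open>k = (m + 1) / 2\<close>, a set of size at least \<open>k\<close> lies in at most
  \<open>C(q - k, m - k)\<close> sets \<open>T\<close>, so up to polynomial factors there are at least
  \<open>C(q, m) / C(q - k, m - k) = C(q, k) / C(m, k) \<ge> C(q, k) / 2^m\<close> admissible sets, and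
  \<open>C(q, k)\<close> is \<open>2^(H(\<alpha>/2) q)\<close> up to a subexponential factor.
\<close>

section \<open>Partitions with prescribed degree parities\<close>

definition degree_in :: "('v \<Rightarrow> 'v \<Rightarrow> bool) \<Rightarrow> 'v set \<Rightarrow> 'v \<Rightarrow> nat" where
  "degree_in E S a = card {b \<in> S. E a b}"

lemma degree_in_Un_disjoint:
  assumes "finite A" "finite B" "A \<inter> B = {}"
  shows "degree_in E (A \<union> B) a = degree_in E A a + degree_in E B a"
proof -
  have "{b \<in> A \<union> B. E a b} = {b \<in> A. E a b} \<union> {b \<in> B. E a b}" by blast
  thus ?thesis unfolding degree_in_def using assms by (subst card_Un_disjoint[symmetric]) auto
qed

lemma degree_in_insert:
  assumes "finite A" "v \<notin> A"
  shows "degree_in E (insert v A) a = degree_in E A a + of_bool (E a v)"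
proof -
  have "{b \<in> insert v A. E a b} = (if E a v then insert v {b \<in> A. E a b} else {b \<in> A. E a b})"
    by auto
  thus ?thesis unfolding degree_in_def using assms by auto
qed

text \<open>With \<open>N\<close> the neighbourhood of a vertex, this is local complementation at
  that vertex.\<close>

definition local_complement :: "('v \<Rightarrow> 'v \<Rightarrow> bool) \<Rightarrow> 'v set \<Rightarrow> 'v \<Rightarrow> 'v \<Rightarrow> bool" where
  "local_complement E N a b = (if a \<in> N \<and> b \<in> N \<and> a \<noteq> b then \<not> E a b else E a b)"

lemma degree_in_local_complement_outside:
  "a \<notin> N \<Longrightarrow> degree_in (local_complement E N) A a = degree_in E A a"
  by (simp add: degree_in_def local_complement_def)

text \<open>Inside \<open>A \<inter> N\<close> the old and new neighbours of \<open>a\<close>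
  partition the points other than \<open>a\<close>, so the two degrees there sum to
  \<open>card (A \<inter> N) - 1\<close>; adjacency to \<open>A - N\<close> is unchanged.\<close>

lemma even_degree_in_local_complement:
  assumes "finite A" "a \<in> A" "a \<in> N" "\<not> E a a"
  shows "even (degree_in (local_complement E N) A a) \<longleftrightarrow> (even (degree_in E A a) \<longleftrightarrow> odd (card (A \<inter> N)))"
proof -
  let ?E = "local_complement E N"
  have split: "degree_in D A a = degree_in D (A \<inter> N) a + degree_in D (A - N) a" for D
    using degree_in_Un_disjoint[of "A \<inter> N" "A - N" D a] assms(1) by (simp add: Int_Diff_Un Int_Diff_disjoint)
  have "degree_in ?E (A - N) a = degree_in E (A - N) a"
    unfolding degree_in_def local_complement_def by (rule arg_cong[of _ _ card]) auto
  moreover have "degree_in ?E (A \<inter> N) a + degree_in E (A \<inter> N) a + 1 = card (A \<inter> N)"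
  proof -
    have "card (A \<inter> N) = card (insert a ({b \<in> A \<inter> N. ?E a b} \<union> {b \<in> A \<inter> N. E a b}))"
      using assms by (intro arg_cong[of _ _ card]) (auto simp: local_complement_def)
    moreover have "card (insert a ({b \<in> A \<inter> N. ?E a b} \<union> {b \<in> A \<inter> N. E a b}))
        = Suc (card ({b \<in> A \<inter> N. ?E a b} \<union> {b \<in> A \<inter> N. E a b}))"
      using assms by (intro card_insert_disjoint) (auto simp: local_complement_def)
    moreover have "card ({b \<in> A \<inter> N. ?E a b} \<union> {b \<in> A \<inter> N. E a b})
        = card {b \<in> A \<inter> N. ?E a b} + card {b \<in> A \<inter> N. E a b}"
      using assms by (intro card_Un_disjoint) (auto simp: local_complement_def)
    ultimately show ?thesis unfolding degree_in_def by linarith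
  qed
  moreover have "even (x + s) \<longleftrightarrow> (even (y + s) \<longleftrightarrow> odd c)" if "x + y + 1 = c" for x y s c :: nat
    using that by presburger
  ultimately show ?thesis using split[of E] split[of ?E] by metis
qed

text \<open>Gallai's theorem. If some vertex has odd degree, delete it, complement the graph on its
  neighbourhood, partition the smaller graph, and put the vertex back into the part that contains
  an even number of its neighbours.\<close>

theorem gallai_even_even_partition:
  fixes E :: "'v \<Rightarrow> 'v \<Rightarrow> bool"
  assumes "finite T" "symp E" "irreflp E"
  shows "\<exists>A B. A \<union> B = T \<and> A \<inter> B = {} \<and> (\<forall>a\<in>A. even (degree_in E A a)) \<and> (\<forall>b\<in>B. even (degree_in E B b))"
  using assms
proof (induction "card T" arbitrary: T E rule: less_induct)
  case less
  show ?case
  proof (cases "\<forall>v\<in>T. even (degree_in E T v)")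
    case True
    then show ?thesis by (intro exI[of _ T] exI[of _ "{}"]) auto
  next
    case False
    then obtain v where v: "v \<in> T" "odd (degree_in E T v)" by blast
    define N where "N = {b \<in> T. E v b}"
    have vN: "v \<notin> N" using less.prems(3) by (auto simp: N_def irreflp_def)
    have irr: "\<not> E a a" for a using less.prems(3) by (auto simp: irreflp_def)
    have sym: "E a b \<longleftrightarrow> E b a" for a b using less.prems(2) by (auto simp: symp_def)
    let ?E = "local_complement E N"
    have "card (T - {v}) < card T" by (rule card_Diff1_less[OF less.prems(1) v(1)])
    moreover have "symp ?E" using sym by (auto simp: symp_def local_complement_def)
    moreover have "irreflp ?E" using irr by (auto simp: irreflp_def local_complement_def)
    ultimately obtain A B where AB: "A \<union> B = T - {v}" "A \<inter> B = {}"
      "\<forall>a\<in>A. even (degree_in ?E A a)" "\<forall>b\<in>B. even (degree_in ?E B b)"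
      using less.hyps[of "T - {v}" ?E] less.prems(1) by blast
    \<comment> \<open>One orientation suffices: \<open>N\<close> has odd size, so exactly one part
      meets it oddly. In that part parities survive undoing the complement; in the other they flip
      exactly on \<open>N\<close>, and adding \<open>v\<close> flips them back.\<close>
    have *: "\<exists>A B. A \<union> B = T \<and> A \<inter> B = {} \<and> (\<forall>a\<in>A. even (degree_in E A a)) \<and> (\<forall>b\<in>B. even (degree_in E B b))"
      if AB: "A \<union> B = T - {v}" "A \<inter> B = {}"
      "\<forall>a\<in>A. even (degree_in ?E A a)" "\<forall>b\<in>B. even (degree_in ?E B b)"
      and par: "odd (card (A \<inter> N))" "even (card (B \<inter> N))" for A B
    proof (rule exI[of _ A], rule exI[of _ "insert v B"], intro conjI ballI)
      have fin: "finite A" "finite B" using AB(1) less.prems(1)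
        by (metis finite_Diff finite_Un)+
      have vB: "v \<notin> B" "v \<notin> A" using AB by auto
      show "A \<union> insert v B = T" using AB v by auto
      show "A \<inter> insert v B = {}" using AB by auto
      show "even (degree_in E A a)" if "a \<in> A" for a
        using AB(3) par(1) that even_degree_in_local_complement[where N = N and E = E, OF fin(1) that _ irr]
          degree_in_local_complement_outside[of a N E A] by (cases "a \<in> N") auto
      show "even (degree_in E (insert v B) b)" if "b \<in> insert v B" for b
      proof (cases "b = v")
        case True
        have "{b \<in> B. E v b} = B \<inter> N" using AB(1) by (auto simp: N_def)
        thus ?thesis using True degree_in_insert[OF fin(2) vB(1), of E v] irr par(2) by (simp add: degree_in_def)
      next
        case False
        hence b: "b \<in> B" using that by auto
        have bN: "b \<in> N \<longleftrightarrow> E b v" using AB b sym by (auto simp: N_def)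
        show ?thesis using AB(4) par(2) b even_degree_in_local_complement[where N = N and E = E, OF fin(2) b _ irr]
          degree_in_local_complement_outside[of b N E B] degree_in_insert[OF fin(2) vB(1), of E b] bN
          by (cases "b \<in> N") auto
      qed
    qed
    have "N = (A \<inter> N) \<union> (B \<inter> N)" using AB(1) vN by (auto simp: N_def)
    moreover have "card ((A \<inter> N) \<union> (B \<inter> N)) = card (A \<inter> N) + card (B \<inter> N)"
      using AB(2) less.prems(1) by (intro card_Un_disjoint) (auto simp: N_def)
    ultimately have "odd (card (A \<inter> N) + card (B \<inter> N))" using v(2) by (simp add: degree_in_def N_def)
    thus ?thesis using *[of A B] *[of B A] AB
      by (cases "odd (card (A \<inter> N))") (simp_all add: Un_commute Int_commute)
  qed
qed

text \<open>The odd part has even size because it is the neighbourhood, within its part, of an added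
  vertex joined to all others.\<close>

corollary gallai_even_odd_partition:
  fixes E :: "'v \<Rightarrow> 'v \<Rightarrow> bool"
  assumes "finite T" "symp E" "irreflp E"
  shows "\<exists>A B. A \<union> B = T \<and> A \<inter> B = {} \<and> (\<forall>a\<in>A. even (degree_in E A a)) \<and> (\<forall>b\<in>B. odd (degree_in E B b)) \<and> even (card B)"
proof -
  \<comment> \<open>\<open>None\<close> is the added vertex, adjacent to every
    \<open>Some a\<close>; removing it lowers all degrees in its part by one.\<close>
  define D where "D = (\<lambda>x y. case (x, y) of (Some a, Some b) \<Rightarrow> E a b | (None, None) \<Rightarrow> False | _ \<Rightarrow> True)"
  have "symp D" using assms(2) by (auto simp: symp_def D_def split: option.splits)
  moreover have "irreflp D" using assms(3) by (auto simp: irreflp_def D_def split: option.splits)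
  ultimately obtain A' B' where AB': "A' \<union> B' = insert None (Some ` T)" "A' \<inter> B' = {}"
    "\<forall>a\<in>A'. even (degree_in D A' a)" "\<forall>b\<in>B'. even (degree_in D B' b)"
    using gallai_even_even_partition[of "insert None (Some ` T)" D] assms(1) by auto
  obtain A' B' where AB: "A' \<union> B' = insert None (Some ` T)" "A' \<inter> B' = {}" "None \<in> B'"
    "\<forall>a\<in>A'. even (degree_in D A' a)" "\<forall>b\<in>B'. even (degree_in D B' b)"
  proof (cases "None \<in> B'")
    case True
    thus ?thesis by (rule that[OF AB'(1,2) _ AB'(3,4)])
  next
    case False
    hence "None \<in> A'" using AB'(1) by blast
    moreover have "B' \<union> A' = insert None (Some ` T)" "B' \<inter> A' = {}" using AB'(1,2) by blast+
    ultimately show ?thesis by (intro that[OF _ _ _ AB'(4,3)])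
  qed
  define A B where "A = {a. Some a \<in> A'}" and "B = {b. Some b \<in> B'}"
  have A': "A' = Some ` A"
  proof (rule Set.set_eqI)
    show "x \<in> A' \<longleftrightarrow> x \<in> Some ` A" for x using AB(2,3) by (cases x) (auto simp: A_def)
  qed
  have B': "B' = insert None (Some ` B)"
  proof (rule Set.set_eqI)
    show "x \<in> B' \<longleftrightarrow> x \<in> insert None (Some ` B)" for x using AB(3) by (cases x) (auto simp: B_def)
  qed
  have "A \<union> B = {a. Some a \<in> A' \<union> B'}" by (auto simp: A_def B_def)
  also have "\<dots> = T" unfolding AB(1) by auto
  finally have AB_T: "A \<union> B = T" "A \<inter> B = {}" using AB(2) by (auto simp: A_def B_def)
  hence fin: "finite A" "finite B" using assms(1) by auto
  have degree_in_Some: "degree_in D (Some ` S) (Some a) = degree_in E S a" for S a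
  proof -
    have "{b \<in> Some ` S. D (Some a) b} = Some ` {b \<in> S. E a b}" by (auto simp: D_def)
    thus ?thesis by (simp add: degree_in_def card_image)
  qed
  have evA: "even (degree_in E A a)" if "a \<in> A" for a
    using AB(4) that degree_in_Some[of A a] unfolding A' by auto
  have "D (Some b) None" for b by (simp add: D_def)
  hence "degree_in D B' (Some b) = degree_in E B b + 1" for b
    unfolding B' using fin by (subst degree_in_insert) (auto simp: degree_in_Some)
  hence oddB: "odd (degree_in E B b)" if "b \<in> B" for b
    using AB(5) that unfolding B' by force
  have "{b \<in> B'. D None b} = Some ` B" unfolding B' by (auto simp: D_def)
  hence "degree_in D B' None = card B" by (simp add: degree_in_def card_image)
  hence "even (card B)" using AB(3,5) by auto
  thus ?thesis using AB_T evA oddB by blast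
qed

text \<open>Mirrors membership in the union: sets of even size need one common degree parity, while
  sets of odd size need character value 1, hence even degrees.\<close>

definition parity_homogeneous :: "('v \<Rightarrow> 'v \<Rightarrow> bool) \<Rightarrow> 'v set \<Rightarrow> bool" where
  "parity_homogeneous E S \<longleftrightarrow>
     (\<forall>a\<in>S. even (degree_in E S a)) \<or> (even (card S) \<and> (\<forall>a\<in>S. odd (degree_in E S a)))"

text \<open>The two obstructions to a usable part: all of \<open>T\<close> may itself be one part,
  or both Gallai partitions may split off a single vertex.\<close>

definition degenerate :: "('v \<Rightarrow> 'v \<Rightarrow> bool) \<Rightarrow> 'v set \<Rightarrow> bool" where
  "degenerate E T \<longleftrightarrow> (\<forall>a\<in>T. even (degree_in E T a)) \<or>
     (\<exists>v\<in>T. \<exists>w\<in>T. v \<noteq> w \<and> (\<forall>z\<in>T - {v, w}. E z v \<noteq> E z w))"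

text \<open>If the even-even partition splits off a single vertex \<open>v\<close> and the even-odd partition
  splits off a single vertex \<open>w\<close>, then comparing degree parities in \<open>T - {v}\<close> and \<open>T - {w}\<close>
  shows that \<open>v\<close> and \<open>w\<close> have complementary neighbourhoods in the rest of \<open>T\<close>.\<close>

lemma ex_large_parity_homogeneous_subset:
  fixes E :: "'v \<Rightarrow> 'v \<Rightarrow> bool"
  assumes fin: "finite T" and E: "symp E" "irreflp E" and T: "odd (card T)" "3 \<le> card T"
    and nd: "\<not> degenerate E T"
  shows "\<exists>S\<subseteq>T. parity_homogeneous E S \<and> card T + 1 \<le> 2 * card S \<and> card S + 2 \<le> card T"
proof (rule ccontr)
  assume none: "\<not> ?thesis"
  \<comment> \<open>Under the negated goal, a parity-homogeneous subset with more than half of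
    \<open>T\<close> misses at most one vertex.\<close>
  have large: "card T \<le> card S + 1"
    if "S \<subseteq> T" "parity_homogeneous E S" "card T + 1 \<le> 2 * card S" for S
    using none that by force
  obtain A B where AB: "A \<union> B = T" "A \<inter> B = {}" "\<forall>a\<in>A. even (degree_in E A a)" "\<forall>b\<in>B. even (degree_in E B b)"
    using gallai_even_even_partition[OF fin E] by blast
  have cAB: "card A + card B = card T" using AB fin by (metis card_Un_disjoint finite_Un)
  have "\<exists>A\<subseteq>T. card T \<le> card A + 1 \<and> (\<forall>a\<in>A. even (degree_in E A a))"
  proof (cases "card T + 1 \<le> 2 * card A")
    case True
    thus ?thesis using large[of A] AB by (auto simp: parity_homogeneous_def)
  next
    case False
    hence "card T + 1 \<le> 2 * card B" using cAB T by presburger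
    thus ?thesis using large[of B] AB by (auto simp: parity_homogeneous_def)
  qed
  then obtain A where A: "A \<subseteq> T" "card T \<le> card A + 1" "\<forall>a\<in>A. even (degree_in E A a)" by blast
  have "A \<noteq> T" using nd A by (auto simp: degenerate_def)
  hence "card A < card T" using psubset_card_mono[OF fin] A(1) by blast
  hence "card (T - A) = 1"
    using A(2) card_Diff_subset[OF finite_subset[OF A(1) fin] A(1)] by linarith
  then obtain v where v: "T - A = {v}" by (auto simp: card_1_singleton_iff)
  obtain C D where CD: "C \<union> D = T" "C \<inter> D = {}" "\<forall>a\<in>C. even (degree_in E C a)" "\<forall>b\<in>D. odd (degree_in E D b)" "even (card D)"
    using gallai_even_odd_partition[OF fin E] by blast
  have cCD: "card C + card D = card T" using CD fin by (metis card_Un_disjoint finite_Un)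
  have "C \<noteq> T" using nd CD by (auto simp: degenerate_def)
  hence "card C < card T" using CD fin by (metis Un_upper1 psubsetI psubset_card_mono)
  \<comment> \<open>\<open>card T\<close> is odd and \<open>card D\<close> even, so
    \<open>card C\<close> is odd and cannot equal \<open>card T - 1\<close>. Hence \<open>D\<close>
    is the larger part.\<close>
  hence "\<not> card T \<le> card C + 1" using cCD CD(5) by presburger
  hence "\<not> card T + 1 \<le> 2 * card C"
    using large[of C] CD(1,3) unfolding parity_homogeneous_def by blast
  hence "card T + 1 \<le> 2 * card D" using cCD T by presburger
  hence "card T \<le> card D + 1" using large[of D] CD by (auto simp: parity_homogeneous_def)
  hence "card C = 1" using cCD T(1) CD(5) by presburger
  then obtain w where w: "C = {w}" by (auto simp: card_1_singleton_iff)
  have finAD: "finite A" "finite D" using A CD fin finite_subset by blast+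
  have TA: "T = insert v A" "v \<notin> A" using v A by auto
  have TD: "T = insert w D" "w \<notin> D" using w CD by auto
  \<comment> \<open>All degrees in \<open>A\<close> are even and all in \<open>D\<close> are odd;
    returning the missing vertex changes the degree of \<open>z\<close> by the edge to it.\<close>
  have pv: "even (degree_in E T z) \<longleftrightarrow> \<not> E z v" if "z \<in> T - {v}" for z
    using degree_in_insert[OF finAD(1) TA(2), of E z] A(3) that TA by auto
  have pw: "even (degree_in E T z) \<longleftrightarrow> E z w" if "z \<in> T - {w}" for z
    using degree_in_insert[OF finAD(2) TD(2), of E z] CD(4) that TD by auto
  have "v \<noteq> w"
  proof
    assume "v = w"
    have "card T = Suc (card A)" using TA finAD(1) by simp
    hence "A \<noteq> {}" using T(2) by auto
    then obtain z where z: "z \<in> T - {v}" using TA by blast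
    show False using pv[OF z] pw[of z] z \<open>v = w\<close> degree_in_insert[OF finAD(1) TA(2), of E z] A(3)
      CD(4) degree_in_insert[OF finAD(2) TD(2), of E z] TA TD by auto
  qed
  moreover have "\<forall>z\<in>T - {v, w}. E z v \<noteq> E z w" using pv pw by blast
  ultimately have "degenerate E T" using TA TD by (auto simp: degenerate_def)
  thus False using nd by blast
qed

section \<open>Counting parity-homogeneous sets\<close>

text \<open>Exchanging \<open>x\<close> for \<open>y\<close> cannot preserve evenness of all degrees unless the other vertices
  do not distinguish \<open>x\<close> from \<open>y\<close>; hence at least one of \<open>insert x W\<close>, \<open>insert y W\<close> has an odd degree
  for most \<open>W\<close>.\<close>

lemma card_nondegenerate_subsets:
  fixes E :: "'v \<Rightarrow> 'v \<Rightarrow> bool" and V :: "'v set"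
  assumes fin: "finite V" and V: "2 \<le> card V" and m: "2 \<le> m"
    and agree: "\<And>v w. v \<in> V \<Longrightarrow> w \<in> V \<Longrightarrow> v \<noteq> w \<Longrightarrow> card {z \<in> V - {v, w}. E z v = E z w} \<le> h"
    and differ: "\<And>v w. v \<in> V \<Longrightarrow> w \<in> V \<Longrightarrow> v \<noteq> w \<Longrightarrow> card {z \<in> V - {v, w}. E z v \<noteq> E z w} \<le> h"
  shows "(card V - 2) choose (m - 1) \<le> card {T. T \<subseteq> V \<and> card T = m \<and> \<not> degenerate E T}
           + (h choose (m - 1)) + (card V)\<^sup>2 * (h choose (m - 2))"
proof -
  obtain x y where xy: "x \<in> V" "y \<in> V" "x \<noteq> y"
    using V fin by (metis card_le_Suc0_iff_eq not_less_eq_eq numeral_2_eq_2)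
  define allev where "allev T = (\<forall>a\<in>T. even (degree_in E T a))" for T
  define D where "D v w = {z \<in> V - {v, w}. E z v \<noteq> E z w}" for v w
  define twins where "twins = {z \<in> V - {x, y}. E z x = E z y}"
  define Ws where "Ws = {W. W \<subseteq> V - {x, y} \<and> card W = m - 1}"
  define Tw where "Tw = {W. W \<subseteq> twins \<and> card W = m - 1}"
  define Od where "Od = {T. T \<subseteq> V \<and> card T = m \<and> \<not> allev T}"
  define Nd where "Nd = {T. T \<subseteq> V \<and> card T = m \<and> \<not> degenerate E T}"
  \<comment> \<open>A set with a complementary pair \<open>v\<close>, \<open>w\<close> consists of
    that pair and \<open>m - 2\<close> vertices of \<open>D v w\<close>.\<close>
  define X where "X v w = (\<lambda>Z. insert v (insert w Z)) ` {Z. Z \<subseteq> D v w \<and> card Z = m - 2}" for v w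
  define An where "An = (\<Union>p \<in> V \<times> V - Id. X (fst p) (snd p))"
  \<comment> \<open>Chooses an extension of \<open>W\<close> with an odd degree; \<open>W\<close> is
    recovered by deleting \<open>x\<close> and \<open>y\<close>, so \<open>f\<close> is
    injective.\<close>
  define f where "f W = (if allev (insert x W) then insert y W else insert x W)" for W
  have fins: "finite Ws" "finite Tw" "finite Od" "finite Nd"
    using fin unfolding Ws_def Tw_def Od_def Nd_def twins_def
    by (auto intro: finite_subset[of _ "Pow V"])
  have finD: "finite (D v w)" for v w using fin by (simp add: D_def)
  have cWs: "card Ws = (card V - 2) choose (m - 1)"
    unfolding Ws_def using fin xy by (subst n_subsets) (auto simp: card_Diff_subset numeral_2_eq_2)
  have cTw: "card Tw \<le> h choose (m - 1)"
    unfolding Tw_def using fin agree[OF xy] by (subst n_subsets) (auto simp: twins_def binomial_right_mono)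
  have "f ` (Ws - Tw) \<subseteq> Od"
  proof (rule image_subsetI)
    fix W assume W: "W \<in> Ws - Tw"
    hence W': "finite W" "x \<notin> W" "y \<notin> W" "W \<subseteq> V" "card W = m - 1"
      using fin by (auto simp: Ws_def intro: finite_subset)
    have "\<not> (allev (insert x W) \<and> allev (insert y W))"
    proof
      assume ev: "allev (insert x W) \<and> allev (insert y W)"
      have "E z x = E z y" if z: "z \<in> W" for z
      proof -
        have "even (degree_in E (insert x W) z)" "even (degree_in E (insert y W) z)"
          using ev z by (auto simp: allev_def)
        thus ?thesis by (cases "E z x"; cases "E z y") (auto simp: degree_in_insert W'(1-3))
      qed
      hence "W \<in> Tw" using W' by (auto simp: Tw_def twins_def)
      thus False using W by auto
    qed
    thus "f W \<in> Od" using W' xy m by (auto simp: f_def Od_def)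
  qed
  moreover have "inj_on f (Ws - Tw)"
  proof (rule inj_on_inverseI)
    show "f W - {x, y} = W" if "W \<in> Ws - Tw" for W using that by (auto simp: f_def Ws_def)
  qed
  ultimately have "card (Ws - Tw) \<le> card Od" using fins by (metis card_inj_on_le)
  hence 1: "card Ws \<le> card Od + card Tw"
    using card_Un_le[of "Ws - Tw" Tw] card_mono[of "(Ws - Tw) \<union> Tw" Ws] fins by force
  have finX: "finite (X v w)" for v w unfolding X_def using finD by simp
  have finAn: "finite An" unfolding An_def using fin finX by simp
  \<comment> \<open>An odd degree excludes the first clause of \<open>degenerate\<close>, leaving
    only complementary pairs.\<close>
  have "Od \<subseteq> Nd \<union> An"
  proof
    fix T assume T: "T \<in> Od"
    show "T \<in> Nd \<union> An"
    proof (cases "degenerate E T")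
      case False
      thus ?thesis using T by (auto simp: Od_def Nd_def)
    next
      case True
      then obtain v w where vw: "v \<in> T" "w \<in> T" "v \<noteq> w" "\<forall>z\<in>T - {v, w}. E z v \<noteq> E z w"
        using T by (auto simp: Od_def degenerate_def allev_def)
      have TV: "T \<subseteq> V" "card T = m" "finite T" using T fin by (auto simp: Od_def intro: finite_subset)
      have "T - {v, w} \<subseteq> D v w" using vw TV by (auto simp: D_def)
      moreover have "card (T - {v, w}) = m - 2" using vw TV by (subst card_Diff_subset) auto
      moreover have "T = insert v (insert w (T - {v, w}))" using vw by auto
      ultimately have "T \<in> X (fst (v, w)) (snd (v, w))" unfolding X_def by auto
      moreover have "(v, w) \<in> V \<times> V - Id" using vw TV by auto
      ultimately have "T \<in> An" unfolding An_def by (rule UN_I[rotated])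
      thus ?thesis by simp
    qed
  qed
  hence "card Od \<le> card Nd + card An"
    using card_mono[of "Nd \<union> An" Od] card_Un_le[of Nd An] fins finAn by fastforce
  moreover have "card An \<le> (card V)\<^sup>2 * (h choose (m - 2))"
  proof -
    have *: "card (X v w) \<le> h choose (m - 2)" if "v \<in> V" "w \<in> V" "v \<noteq> w" for v w
    proof -
      have "card (X v w) \<le> card {Z. Z \<subseteq> D v w \<and> card Z = m - 2}"
        unfolding X_def using finD by (intro card_image_le) simp
      also have "\<dots> = card (D v w) choose (m - 2)" by (rule n_subsets[OF finD])
      also have "\<dots> \<le> h choose (m - 2)" using differ[OF that] by (simp add: D_def binomial_right_mono)
      finally show ?thesis .
    qed
    have "card An \<le> (\<Sum>p\<in>V \<times> V - Id. card (X (fst p) (snd p)))"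
      unfolding An_def using fin by (intro card_UN_le) simp
    also have "\<dots> \<le> (\<Sum>p\<in>V \<times> V - Id. h choose (m - 2))"
      by (intro sum_mono *) auto
    also have "\<dots> = card (V \<times> V - Id) * (h choose (m - 2))" by simp
    also have "\<dots> \<le> (card V)\<^sup>2 * (h choose (m - 2))"
      using card_mono[of "V \<times> V" "V \<times> V - Id"] fin
      by (intro mult_right_mono) (auto simp: card_cartesian_product power2_eq_square)
    finally show ?thesis .
  qed
  ultimately show ?thesis using 1 cWs cTw unfolding Nd_def by linarith
qed

section \<open>Double counting of sets and their supersets\<close>

lemma card_supersets:
  assumes "finite V" "S \<subseteq> V" "card S \<le> m"
  shows "card {T. S \<subseteq> T \<and> T \<subseteq> V \<and> card T = m} = (card V - card S) choose (m - card S)"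
proof -
  have fS: "finite S" using assms finite_subset by blast
  have "{T. S \<subseteq> T \<and> T \<subseteq> V \<and> card T = m} = (\<lambda>U. S \<union> U) ` {U. U \<subseteq> V - S \<and> card U = m - card S}" (is "?L = ?R")
  proof (intro equalityI subsetI)
    fix T assume T: "T \<in> ?L"
    hence "card (T - S) = m - card S" using fS by (simp add: card_Diff_subset)
    moreover have "T = S \<union> (T - S)" using T by auto
    ultimately show "T \<in> ?R" using T by blast
  next
    fix T assume "T \<in> ?R"
    then obtain U where U: "T = S \<union> U" "U \<subseteq> V - S" "card U = m - card S" by auto
    have "card T = card S + card U"
      using U assms fS finite_subset[of U V] by (simp, subst card_Un_disjoint) auto
    thus "T \<in> ?L" using U assms by auto
  qed
  moreover have "inj_on (\<lambda>U. S \<union> U) {U. U \<subseteq> V - S \<and> card U = m - card S}"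
    by (rule inj_on_inverseI[where g = "\<lambda>T. T - S"]) auto
  ultimately show ?thesis
    using assms fS by (simp add: card_image n_subsets card_Diff_subset)
qed

text \<open>By symmetry both sides have lower index \<open>n - m\<close>, so only the upper index
  varies. A larger set thus has no more supersets of size \<open>m\<close>.\<close>

lemma binomial_diff_mono:
  assumes "k \<le> s" "s \<le> m" "m \<le> n"
  shows "(n - s) choose (m - s) \<le> (n - k) choose (m - k)"
proof -
  have "(n - s) choose (m - s) = (n - s) choose (n - m)"
    using assms by (subst binomial_symmetric) auto
  also have "\<dots> \<le> (n - k) choose (n - m)" using assms by (intro binomial_right_mono) auto
  also have "\<dots> = (n - k) choose (m - k)" using assms by (subst binomial_symmetric) auto
  finally show ?thesis .
qed

lemma card_subsets_containing_le:
  assumes fin: "finite V" and m: "m \<le> card V"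
    and TS: "\<And>T. T \<in> \<T> \<Longrightarrow> T \<subseteq> V \<and> card T = m \<and> (\<exists>S\<in>\<S>. S \<subseteq> T)"
    and S: "\<And>S. S \<in> \<S> \<Longrightarrow> S \<subseteq> V \<and> k \<le> card S \<and> card S \<le> m"
  shows "card \<T> \<le> card \<S> * ((card V - k) choose (m - k))"
proof -
  define X where "X S = {T. S \<subseteq> T \<and> T \<subseteq> V \<and> card T = m}" for S
  have finX: "finite (X S)" for S using fin by (auto simp: X_def intro: finite_subset[of _ "Pow V"])
  have finS: "finite \<S>" using fin S by (meson PowI finite_Pow_iff finite_subset subsetI)
  have "\<T> \<subseteq> (\<Union>S\<in>\<S>. X S)" using TS by (fastforce simp: X_def)
  hence "card \<T> \<le> card (\<Union>S\<in>\<S>. X S)" using finS finX by (intro card_mono) auto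
  also have "\<dots> \<le> (\<Sum>S\<in>\<S>. card (X S))" by (rule card_UN_le[OF finS])
  also have "\<dots> \<le> (\<Sum>S\<in>\<S>. (card V - k) choose (m - k))"
  proof (rule sum_mono)
    fix A assume "A \<in> \<S>"
    hence "A \<subseteq> V" "k \<le> card A" "card A \<le> m" using S by auto
    thus "card (X A) \<le> (card V - k) choose (m - k)"
      unfolding X_def using fin m by (simp add: card_supersets binomial_diff_mono)
  qed
  finally show ?thesis by simp
qed

text \<open>The union bound over supersets, multiplied by \<open>card V choose k\<close> and
  rewritten by C(n,k) C(n-k,m-k) = C(n,m) C(m,k), with C(m,k) \<le> 2^m. Keeping products avoids
  division in the naturals.\<close>

lemma card_parity_homogeneous_ge:
  fixes E :: "'v \<Rightarrow> 'v \<Rightarrow> bool" and V :: "'v set"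
  assumes fin: "finite V" and E: "symp E" "irreflp E" and m: "odd m" "3 \<le> m" "m \<le> card V"
  shows "card {T. T \<subseteq> V \<and> card T = m \<and> \<not> degenerate E T} * (card V choose ((m + 1) div 2))
    \<le> card {S. S \<subseteq> V \<and> parity_homogeneous E S \<and> m + 1 \<le> 2 * card S \<and> card S + 2 \<le> m}
       * (card V choose m) * 2 ^ m"
    (is "card ?T * _ \<le> card ?S * _ * _")
proof -
  define k where "k = (m + 1) div 2"
  have k: "k \<le> m" "2 * k = m + 1" using m by (auto simp: k_def)
  have "card ?T \<le> card ?S * ((card V - k) choose (m - k))"
  proof (rule card_subsets_containing_le[OF fin m(3)])
    fix T assume T: "T \<in> ?T"
    hence "finite T" using fin finite_subset by blast
    then obtain S where "S \<subseteq> T" "parity_homogeneous E S" "m + 1 \<le> 2 * card S" "card S + 2 \<le> m"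
      using ex_large_parity_homogeneous_subset[of T E] E T m by auto
    thus "T \<subseteq> V \<and> card T = m \<and> (\<exists>S\<in>?S. S \<subseteq> T)" using T by blast
  qed (use k in auto)
  hence "card ?T * (card V choose k) \<le> card ?S * ((card V - k) choose (m - k)) * (card V choose k)"
    by (rule mult_right_mono) simp
  also have "\<dots> = card ?S * (card V choose m) * (m choose k)"
    using choose_mult[OF k(1) m(3)] by (simp add: mult.assoc mult.commute mult.left_commute)
  also have "\<dots> \<le> card ?S * (card V choose m) * 2 ^ m"
    by (intro mult_left_mono binomial_le_pow2) simp
  finally show ?thesis by (simp add: k_def)
qed

section \<open>The graph of nonsquare differences\<close>

locale field_1_mod_4 = field F for F (structure) +
  assumes fin: "finite (carrier F)" and card_mod_4: "card (carrier F) mod 4 = 1"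
begin

abbreviation q where "q \<equiv> card (carrier F)"

section \<open>The quadratic character through a generator of the multiplicative group\<close>

lemma q_gt_1: "q > 1"
proof -
  have "card {\<zero>, \<one>} \<le> q" by (rule card_mono[OF fin]) auto
  thus ?thesis by simp
qed

text \<open>The multiplicative group is cyclic of order \<open>q - 1\<close>. The bound on
  \<open>i\<close> later allows the powers of a given parity to be counted.\<close>

lemma ex_generator:
  "\<exists>g\<in>carrier F - {\<zero>}. (\<forall>x\<in>carrier F - {\<zero>}. \<exists>i<q - 1. x = g [^] (i::nat)) \<and>
     (\<forall>n::nat. g [^] n = \<one> \<longleftrightarrow> q - 1 dvd n)"
proof -
  interpret G: group "mult_of F" rewrites
      "([^]\<^bsub>mult_of F\<^esub>) = (([^]) :: _ \<Rightarrow> nat \<Rightarrow> _)" and "\<one>\<^bsub>mult_of F\<^esub> = \<one>"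
    by (rule field_mult_group) (simp_all add: fun_eq_iff nat_pow_def nat_pow_mult_of)
  have fin': "finite (carrier (mult_of F))" using fin by simp
  obtain g where g: "g \<in> carrier (mult_of F)" "carrier (mult_of F) = {g [^] i | i::nat. i \<in> UNIV}"
    using finite_field_mult_group_has_gen[OF fin] by blast
  have "G.ord g = card (carrier (mult_of F))"
    unfolding G.generate_pow_card[OF g(1)] G.generate_pow_on_finite_carrier[OF fin' g(1)] g(2) ..
  hence ord: "G.ord g = q - 1" using fin by simp
  have "\<exists>i<q - 1. x = g [^] (i::nat)" if x: "x \<in> carrier F - {\<zero>}" for x
  proof -
    have "x \<in> {g [^] x | x. x \<in> {0 .. G.ord g - 1}}"
      using x unfolding G.ord_elems[OF fin' g(1), symmetric] g(2)[symmetric] by simp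
    then obtain i where "x = g [^] i" "i \<le> q - 1 - 1" using ord by auto
    moreover have "q - 1 - 1 < q - 1" using q_gt_1 by linarith
    ultimately show ?thesis using le_less_trans by blast
  qed
  moreover have "\<forall>n::nat. g [^] n = \<one> \<longleftrightarrow> q - 1 dvd n" using G.pow_eq_id[OF g(1)] unfolding ord by blast
  moreover have "g \<in> carrier F - {\<zero>}" using g(1) by simp
  ultimately show ?thesis by blast
qed

definition gen where
  "gen = (SOME g. g \<in> carrier F - {\<zero>} \<and> (\<forall>x\<in>carrier F - {\<zero>}. \<exists>i<q - 1. x = g [^] (i::nat)) \<and>
     (\<forall>n::nat. g [^] n = \<one> \<longleftrightarrow> q - 1 dvd n))"

lemma gen: "gen \<in> carrier F" "gen \<noteq> \<zero>"
  "\<And>x. x \<in> carrier F \<Longrightarrow> x \<noteq> \<zero> \<Longrightarrow> \<exists>i<q - 1. x = gen [^] (i::nat)"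
  "\<And>n::nat. gen [^] n = \<one> \<longleftrightarrow> q - 1 dvd n"
proof -
  have *: "gen \<in> carrier F - {\<zero>} \<and> (\<forall>x\<in>carrier F - {\<zero>}. \<exists>i<q - 1. x = gen [^] (i::nat)) \<and>
     (\<forall>n::nat. gen [^] n = \<one> \<longleftrightarrow> q - 1 dvd n)"
    unfolding gen_def by (rule someI_ex) (use ex_generator in \<open>unfold Bex_def\<close>)
  show "gen \<in> carrier F" "gen \<noteq> \<zero>" using conjunct1[OF *] by simp_all
  show "\<And>x. x \<in> carrier F \<Longrightarrow> x \<noteq> \<zero> \<Longrightarrow> \<exists>i<q - 1. x = gen [^] (i::nat)"
    using conjunct1[OF conjunct2[OF *]] by simp
  show "\<And>n::nat. gen [^] n = \<one> \<longleftrightarrow> q - 1 dvd n"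
    using conjunct2[OF conjunct2[OF *]] by (rule spec)
qed

lemma gen_pow_nonzero: "gen [^] (n::nat) \<noteq> \<zero>"
  using gen(1,2) by (induction n) (simp_all add: integral_iff)

lemma even_q_minus_1: "even (q - 1)" "even ((q - 1) div 2)"
proof -
  have "even (n - 1)" "even ((n - 1) div 2)" if "n mod 4 = 1" for n :: nat
    using that by presburger+
  thus "even (q - 1)" "even ((q - 1) div 2)" using card_mod_4 by blast+
qed

text \<open>Exponents are determined modulo \<open>q - 1\<close>, which is even.\<close>

lemma gen_pow_eq_parity:
  assumes "gen [^] (i::nat) = gen [^] (j::nat)" shows "even i \<longleftrightarrow> even j"
proof -
  have *: "even i \<longleftrightarrow> even j" if "i \<le> j" "gen [^] i = gen [^] j" for i j :: nat
  proof -
    have "gen [^] i \<otimes> gen [^] (j - i) = gen [^] i \<otimes> \<one>"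
      using that gen(1) nat_pow_mult[OF gen(1), of i "j - i"] by simp
    hence "gen [^] (j - i) = \<one>"
      using m_lcancel[OF gen_pow_nonzero[of i], of "gen [^] (j - i)" \<one>] gen(1)
      by simp
    hence "even (j - i)" using gen(4) even_q_minus_1(1) by (meson dvd_trans)
    thus ?thesis using that(1) by presburger
  qed
  show ?thesis using *[of i j] *[of j i] assms linear[of i j] by metis
qed

lemma quad_char_gen_pow: "quad_char F (gen [^] (i::nat)) = (-1) ^ i"
proof (cases "even i")
  case True
  then obtain k where "i = k + k" by (auto elim!: evenE simp: mult_2)
  hence "gen [^] i = gen [^] k \<otimes> gen [^] k" using gen(1) by (simp add: nat_pow_mult)
  thus ?thesis using True gen(1) gen_pow_nonzero unfolding quad_char_def by auto
next
  case False
  have "\<not> (\<exists>y\<in>carrier F. gen [^] i = y \<otimes> y)"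
  proof
    assume "\<exists>y\<in>carrier F. gen [^] i = y \<otimes> y"
    then obtain y where y: "y \<in> carrier F" "gen [^] i = y \<otimes> y" by blast
    hence "y \<noteq> \<zero>" using gen_pow_nonzero[of i] by auto
    then obtain j :: nat where "y = gen [^] j" using gen(3) y by blast
    hence "gen [^] i = gen [^] (j + j)" using y gen(1) by (simp add: nat_pow_mult)
    thus False using gen_pow_eq_parity[of i "j + j"] False by simp
  qed
  thus ?thesis using False gen_pow_nonzero unfolding quad_char_def by auto
qed

lemma quad_char_nonzero:
  assumes "x \<in> carrier F" "x \<noteq> \<zero>" shows "quad_char F x = 1 \<or> quad_char F x = -1"
  using assms by (auto simp: quad_char_def)

lemma quad_char_mult:
  assumes "x \<in> carrier F" "y \<in> carrier F" "x \<noteq> \<zero>" "y \<noteq> \<zero>"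
  shows "quad_char F (x \<otimes> y) = quad_char F x * quad_char F y"
proof -
  obtain i j :: nat where "x = gen [^] i" "y = gen [^] j" using gen(3) assms by metis
  thus ?thesis using gen(1) by (simp add: nat_pow_mult quad_char_gen_pow power_add)
qed

lemma minus_nonzero:
  assumes "x \<in> carrier F" "y \<in> carrier F" "x \<noteq> y"
  shows "x \<ominus> y \<in> carrier F" "x \<ominus> y \<noteq> \<zero>"
  using assms by simp_all

text \<open>The power of \<open>gen\<close> with exponent \<open>(q - 1) div 2\<close> squares to 1
  without being 1, so it is -1; for q = 1 mod 4 this exponent is even, making -1 a square.\<close>

lemma quad_char_uminus:
  assumes "x \<in> carrier F" shows "quad_char F (\<ominus> x) = quad_char F x"
proof (cases "x = \<zero>")
  case False
  let ?h = "gen [^] ((q - 1) div 2)"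
  have h: "?h \<in> carrier F" using gen(1) by simp
  have "?h \<otimes> ?h = \<one>" using gen(1,4) even_q_minus_1 by (simp add: nat_pow_mult flip: mult_2)
  hence "(?h \<oplus> \<one>) \<otimes> (?h \<ominus> \<one>) = \<zero>" using h by algebra
  moreover have "?h \<noteq> \<one>"
  proof -
    have "0 < (q - 1) div 2" "(q - 1) div 2 < q - 1" using q_gt_1 even_q_minus_1 by presburger+
    hence "\<not> q - 1 dvd (q - 1) div 2" by (simp add: nat_dvd_not_less)
    thus ?thesis using gen(4) by blast
  qed
  ultimately have "?h \<oplus> \<one> = \<zero>" using h by (simp add: integral_iff)
  hence "?h = \<ominus> \<one>" using minus_equality[OF _ one_closed h] by simp
  hence "\<ominus> x = ?h \<otimes> x" using l_minus[OF one_closed assms] assms by simp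
  moreover have "quad_char F (?h \<otimes> x) = quad_char F ?h * quad_char F x"
    by (rule quad_char_mult[OF h assms gen_pow_nonzero False])
  moreover have "quad_char F ?h = 1" unfolding quad_char_gen_pow using even_q_minus_1(2) by simp
  ultimately show ?thesis by presburger
qed simp

text \<open>Nonsquare differences are the edges so that degrees count the factors -1 in
  \<open>Delta\<close>. The carrier conditions give symmetry and irreflexivity on the whole type, as
  Gallai's theorem requires.\<close>

definition nonsq_diff where
  "nonsq_diff a b \<longleftrightarrow> a \<in> carrier F \<and> b \<in> carrier F \<and> quad_char F (a \<ominus> b) = -1"

lemma symp_nonsq_diff: "symp nonsq_diff"
proof (rule sympI)
  fix a b assume "nonsq_diff a b"
  hence ab: "a \<in> carrier F" "b \<in> carrier F" "quad_char F (a \<ominus> b) = -1" by (auto simp: nonsq_diff_def)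
  have "b \<ominus> a = \<ominus> (a \<ominus> b)" using ab by algebra
  thus "nonsq_diff b a" using ab quad_char_uminus[of "a \<ominus> b"] by (simp add: nonsq_diff_def)
qed

lemma irreflp_nonsq_diff: "irreflp nonsq_diff"
proof (rule irreflpI)
  fix a
  have "quad_char F (a \<ominus> a) = 0" if "a \<in> carrier F"
    unfolding quad_char_def using r_right_minus_eq[OF that that] by simp
  thus "\<not> nonsq_diff a a" by (auto simp: nonsq_diff_def)
qed

text \<open>Nonvanishing is carried through the induction because \<open>quad_char_mult\<close>
  needs nonzero factors.\<close>

lemma quad_char_finprod:
  assumes "finite A" "f \<in> A \<rightarrow> carrier F - {\<zero>}"
  shows "(\<Otimes>a\<in>A. f a) \<noteq> \<zero> \<and> quad_char F (\<Otimes>a\<in>A. f a) = (-1) ^ card {a \<in> A. quad_char F (f a) = -1}"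
  using assms
proof (induction A rule: finite_induct)
  case empty
  have "quad_char F \<one> = 1" using quad_char_gen_pow[of 0] by simp
  thus ?case by simp
next
  case (insert a A)
  have f: "f \<in> A \<rightarrow> carrier F" "f a \<in> carrier F" "f a \<noteq> \<zero>" using insert.prems by auto
  have IH: "(\<Otimes>a\<in>A. f a) \<noteq> \<zero>" "quad_char F (\<Otimes>a\<in>A. f a) = (-1) ^ card {a \<in> A. quad_char F (f a) = -1}"
    using insert by auto
  have "{b \<in> insert a A. quad_char F (f b) = -1} =
    (if quad_char F (f a) = -1 then insert a {a \<in> A. quad_char F (f a) = -1} else {a \<in> A. quad_char F (f a) = -1})"
    by auto
  thus ?case using insert.hyps f IH quad_char_nonzero[OF f(2,3)]
    by (auto simp: quad_char_mult integral_iff)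
qed

lemma quad_char_Delta:
  assumes "S \<subseteq> carrier F" "a \<in> S"
  shows "Delta F S a \<in> carrier F" "quad_char F (Delta F S a) = (-1) ^ degree_in nonsq_diff S a"
proof -
  have finS: "finite S" using assms fin finite_subset by blast
  have diff: "(\<lambda>b. a \<ominus> b) \<in> S - {a} \<rightarrow> carrier F - {\<zero>}"
  proof (rule Pi_I)
    fix b assume "b \<in> S - {a}"
    hence "a \<in> carrier F" "b \<in> carrier F" "a \<noteq> b" using assms by auto
    thus "a \<ominus> b \<in> carrier F - {\<zero>}" by simp
  qed
  thus "Delta F S a \<in> carrier F" unfolding Delta_def by (intro finprod_closed) auto
  have "{b \<in> S. nonsq_diff a b} = {b \<in> S - {a}. quad_char F (a \<ominus> b) = -1}"
    using assms irreflp_nonsq_diff by (auto simp: nonsq_diff_def irreflp_def)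
  thus "quad_char F (Delta F S a) = (-1) ^ degree_in nonsq_diff S a"
    unfolding Delta_def degree_in_def using quad_char_finprod[OF _ diff] finS by simp
qed

lemma parity_homogeneous_imp_Omega:
  assumes S: "S \<subseteq> carrier F" and hom: "parity_homogeneous nonsq_diff S"
  shows "S \<in> Omega F (card S) \<union> Omega_ext F (card S + 1)"
proof -
  have finS: "finite S" using S fin finite_subset by blast
  show ?thesis
  proof (cases "even (card S)")
    case True
    thus ?thesis using hom S finS quad_char_Delta[OF S]
      by (auto simp: Omega_def parity_homogeneous_def)
  next
    case False
    thus ?thesis using hom S finS quad_char_Delta[OF S]
      by (auto simp: Omega_ext_def parity_homogeneous_def quad_char_uminus)
  qed
qed

text \<open>The map \<open>z \<mapsto> (z - v) / (z - w)\<close> is injective, and its value is a square exactly when \<open>z\<close>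
  relates equally to \<open>v\<close> and \<open>w\<close>.\<close>

lemma card_quad_char_quotient:
  assumes vw: "v \<in> carrier F" "w \<in> carrier F" "v \<noteq> w" and s: "s = 1 \<or> s = -1"
  shows "card {z \<in> carrier F - {v, w}. quad_char F (z \<ominus> v) * quad_char F (z \<ominus> w) = s} \<le> (q - 1) div 2"
    (is "card ?Z \<le> _")
proof -
  define f where "f z = (z \<ominus> v) \<otimes> inv (z \<ominus> w)" for z
  have nz: "z \<ominus> v \<in> carrier F" "z \<ominus> v \<noteq> \<zero>" "z \<ominus> w \<in> carrier F" "z \<ominus> w \<noteq> \<zero>"
    "inv (z \<ominus> w) \<in> carrier F" "inv (z \<ominus> w) \<noteq> \<zero>" "inv (z \<ominus> w) \<otimes> (z \<ominus> w) = \<one>"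
    if "z \<in> carrier F - {v, w}" for z
  proof -
    have z: "z \<in> carrier F" "z \<noteq> v" "z \<noteq> w" using that by simp_all
    show 1: "z \<ominus> v \<in> carrier F" "z \<ominus> v \<noteq> \<zero>" "z \<ominus> w \<in> carrier F" "z \<ominus> w \<noteq> \<zero>"
      by (fact minus_nonzero[OF z(1) vw(1) z(2)] minus_nonzero[OF z(1) vw(2) z(3)])+
    hence "z \<ominus> w \<in> Units F" by (simp add: field_Units)
    thus 2: "inv (z \<ominus> w) \<in> carrier F" "inv (z \<ominus> w) \<otimes> (z \<ominus> w) = \<one>" by auto
    show "inv (z \<ominus> w) \<noteq> \<zero>" using 1 2 by auto
  qed
  have inj: "inj_on f (carrier F - {v, w})"
  proof (rule inj_onI)
    fix x y assume xy: "x \<in> carrier F - {v, w}" "y \<in> carrier F - {v, w}" "f x = f y"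
    have f_mult: "f z \<otimes> (z \<ominus> w) = z \<ominus> v" if "z \<in> carrier F - {v, w}" for z
      unfolding f_def using nz[OF that] by (simp add: m_assoc)
    have c: "x \<in> carrier F" "y \<in> carrier F" "f x \<in> carrier F" using xy nz by (auto simp: f_def)
    have "(x \<ominus> v) \<otimes> (y \<ominus> w) = (y \<ominus> v) \<otimes> (x \<ominus> w)"
    proof -
      have "(x \<ominus> v) \<otimes> (y \<ominus> w) = f x \<otimes> (x \<ominus> w) \<otimes> (y \<ominus> w)" using f_mult[OF xy(1)] by simp
      also have "\<dots> = f x \<otimes> (y \<ominus> w) \<otimes> (x \<ominus> w)" using c vw by (simp add: m_ac)
      also have "\<dots> = (y \<ominus> v) \<otimes> (x \<ominus> w)" using f_mult[OF xy(2)] xy(3) by simp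
      finally show ?thesis .
    qed
    \<comment> \<open>Cross-multiplying \<open>f x = f y\<close> makes the right side vanish, and
      \<open>v \<noteq> w\<close> then forces \<open>x = y\<close>.\<close>
    moreover have "(x \<ominus> y) \<otimes> (v \<ominus> w) = (x \<ominus> v) \<otimes> (y \<ominus> w) \<ominus> (y \<ominus> v) \<otimes> (x \<ominus> w)"
      using c vw by algebra
    ultimately have "(x \<ominus> y) \<otimes> (v \<ominus> w) = \<zero>" using c vw by simp
    thus "x = y" using c vw by (simp add: integral_iff)
  qed
  have sq: "quad_char F (f z) = quad_char F (z \<ominus> v) * quad_char F (z \<ominus> w)" if "z \<in> carrier F - {v, w}" for z
  proof -
    note n = nz[OF that]
    have "quad_char F (inv (z \<ominus> w)) * quad_char F (z \<ominus> w) = 1"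
      using quad_char_mult[OF n(5,3,6,4)] n(7) quad_char_gen_pow[of 0] by simp
    hence "quad_char F (inv (z \<ominus> w)) = quad_char F (z \<ominus> w)"
      using quad_char_nonzero[OF n(3,4)] by auto
    thus ?thesis unfolding f_def using quad_char_mult[OF n(1,5,2,6)] by simp
  qed
  \<comment> \<open>The exponent parity belonging to the sign \<open>s\<close>; below
    \<open>q - 1\<close> there are \<open>(q - 1) div 2\<close> exponents of each parity.\<close>
  define r where "r = (if s = 1 then 0 else 1 :: nat)"
  have "f ` ?Z \<subseteq> (\<lambda>j. gen [^] (2 * j + r)) ` {..<(q - 1) div 2}"
  proof (rule image_subsetI)
    fix z assume z: "z \<in> ?Z"
    hence "f z \<in> carrier F" "f z \<noteq> \<zero>" using nz[of z] by (auto simp: f_def integral_iff)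
    then obtain i :: nat where i: "i < q - 1" "f z = gen [^] i" using gen(3) by blast
    have "(-1) ^ i = s" using sq[of z] z i quad_char_gen_pow[of i] by simp
    hence "even i \<longleftrightarrow> r = 0" using s by (cases "even i") (auto simp: r_def)
    hence "i = 2 * (i div 2) + r" by (auto simp: r_def split: if_splits)
    moreover have "i div 2 < (q - 1) div 2" using i even_q_minus_1 by presburger
    ultimately show "f z \<in> (\<lambda>j. gen [^] (2 * j + r)) ` {..<(q - 1) div 2}"
      using i(2) by (metis (no_types, lifting) imageI lessThan_iff)
  qed
  hence "card (f ` ?Z) \<le> card {..<(q - 1) div 2}" by (rule surj_card_le[rotated]) simp
  moreover have "card (f ` ?Z) = card ?Z" by (rule card_image) (rule inj_on_subset[OF inj], auto)
  ultimately show ?thesis by simp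
qed

lemma card_agree_differ:
  assumes "v \<in> carrier F" "w \<in> carrier F" "v \<noteq> w"
  shows "card {z \<in> carrier F - {v, w}. nonsq_diff z v = nonsq_diff z w} \<le> (q - 1) div 2"
    and "card {z \<in> carrier F - {v, w}. nonsq_diff z v \<noteq> nonsq_diff z w} \<le> (q - 1) div 2"
proof -
  have pm: "quad_char F (z \<ominus> v) = 1 \<or> quad_char F (z \<ominus> v) = -1"
    "quad_char F (z \<ominus> w) = 1 \<or> quad_char F (z \<ominus> w) = -1" if "z \<in> carrier F - {v, w}" for z
  proof -
    have z: "z \<in> carrier F" "z \<noteq> v" "z \<noteq> w" using that by simp_all
    show "quad_char F (z \<ominus> v) = 1 \<or> quad_char F (z \<ominus> v) = -1"
      by (rule quad_char_nonzero[OF minus_nonzero[OF z(1) assms(1) z(2)]])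
    show "quad_char F (z \<ominus> w) = 1 \<or> quad_char F (z \<ominus> w) = -1"
      by (rule quad_char_nonzero[OF minus_nonzero[OF z(1) assms(2) z(3)]])
  qed
  have eq: "nonsq_diff z v = nonsq_diff z w \<longleftrightarrow> quad_char F (z \<ominus> v) * quad_char F (z \<ominus> w) = 1"
    and ne: "nonsq_diff z v \<noteq> nonsq_diff z w \<longleftrightarrow> quad_char F (z \<ominus> v) * quad_char F (z \<ominus> w) = -1"
    if "z \<in> carrier F - {v, w}" for z
    using pm[OF that] that assms(1,2) unfolding nonsq_diff_def by auto
  have "{z \<in> carrier F - {v, w}. nonsq_diff z v = nonsq_diff z w}
      = {z \<in> carrier F - {v, w}. quad_char F (z \<ominus> v) * quad_char F (z \<ominus> w) = 1}"
    by (intro Collect_cong conj_cong refl eq)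
  thus "card {z \<in> carrier F - {v, w}. nonsq_diff z v = nonsq_diff z w} \<le> (q - 1) div 2"
    using card_quad_char_quotient[OF assms, of 1] by simp
  have "{z \<in> carrier F - {v, w}. nonsq_diff z v \<noteq> nonsq_diff z w}
      = {z \<in> carrier F - {v, w}. quad_char F (z \<ominus> v) * quad_char F (z \<ominus> w) = -1}"
    by (intro Collect_cong conj_cong refl ne)
  thus "card {z \<in> carrier F - {v, w}. nonsq_diff z v \<noteq> nonsq_diff z w} \<le> (q - 1) div 2"
    using card_quad_char_quotient[OF assms, of "-1"] by simp
qed

end

section \<open>Binomial coefficients and entropy\<close>

text \<open>Equivalently k^j / j! \<le> k^k / k!: passing from j to j + 1 multiplies by k / (j + 1),
  so the terms do not fall before j = k and do not rise after it.\<close>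

lemma fact_mult_power_le: "fact k * k ^ j \<le> (fact j * k ^ k :: nat)"
proof (cases "k \<le> j")
  case True
  have "fact k * k ^ d \<le> (fact (k + d) :: nat)" for d
  proof (induction d)
    case (Suc d)
    have "fact k * k ^ Suc d = k * (fact k * k ^ d)" by simp
    also have "\<dots> \<le> (k + d + 1) * fact (k + d)" using Suc by (intro mult_mono) auto
    finally show ?case by (simp add: algebra_simps)
  qed simp
  from mult_right_mono[OF this[of "j - k"], of "k ^ k"] show ?thesis
    using True by (simp add: algebra_simps flip: power_add)
next
  case False
  have "fact (j + d) \<le> (fact j * k ^ d :: nat)" if "j + d \<le> k" for d
    using that
  proof (induction d)
    case (Suc d)
    have "fact (j + Suc d) = (j + d + 1) * (fact (j + d) :: nat)" by simp
    also have "\<dots> \<le> k * (fact j * k ^ d)" using Suc by (intro mult_mono) auto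
    finally show ?case by (simp add: algebra_simps)
  qed simp
  from mult_right_mono[OF this[of "k - j"], of "k ^ j"] show ?thesis
    using False by (simp add: algebra_simps flip: power_add)
qed

text \<open>The largest term of the binomial expansion of \<open>(k + (n - k)) ^ n\<close> is the one with index \<open>k\<close>.\<close>

lemma binomial_ge_max_term:
  assumes "k \<le> n"
  shows "real n ^ n \<le> real (n + 1) * (real (n choose k) * real k ^ k * real (n - k) ^ (n - k))"
proof -
  have frac: "real a ^ j / fact j \<le> real a ^ a / fact a" for a j :: nat
  proof -
    have "real (fact a * a ^ j) \<le> real (fact j * a ^ a)"
      using fact_mult_power_le[of a j] by (rule of_nat_mono)
    thus ?thesis by (simp add: divide_simps mult.commute)
  qed
  \<comment> \<open>Each term splits into a factor in \<open>j\<close> and one in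
    \<open>n - j\<close>, and both are maximal at \<open>j = k\<close>.\<close>
  have term_eq: "real (n choose j) * real k ^ j * real (n - k) ^ (n - j)
      = fact n * (real k ^ j / fact j) * (real (n - k) ^ (n - j) / fact (n - j))" if "j \<le> n" for j
    using that by (simp add: binomial_fact)
  have "real n ^ n = (real k + real (n - k)) ^ n" using assms by simp
  also have "\<dots> = (\<Sum>j\<le>n. real (n choose j) * real k ^ j * real (n - k) ^ (n - j))"
    by (rule binomial_ring)
  also have "\<dots> \<le> (\<Sum>j\<le>n. real (n choose k) * real k ^ k * real (n - k) ^ (n - k))"
  proof (rule sum_mono)
    fix j assume "j \<in> {..n}"
    hence j: "j \<le> n" by simp
    show "real (n choose j) * real k ^ j * real (n - k) ^ (n - j)
        \<le> real (n choose k) * real k ^ k * real (n - k) ^ (n - k)"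
      unfolding term_eq[OF j] term_eq[OF assms]
      by (intro mult_mono mult_left_mono frac) auto
  qed
  finally show ?thesis by simp
qed

text \<open>The logarithm of \<open>binomial_ge_max_term\<close>; bounding all n + 1 terms by the
  largest costs log(n + 1).\<close>

lemma log_binomial_ge_entropy:
  assumes "0 < k" "k < n"
  shows "real n * binary_entropy (real k / real n) - log 2 (real n + 1) \<le> log 2 (real (n choose k))"
proof -
  have pos: "real k > 0" "real (n - k) > 0" "real n > 0" "real (n choose k) > 0" using assms by auto
  have "real n * log 2 (real n) = log 2 (real n ^ n)" using pos by (simp add: log_nat_power)
  also have "\<dots> \<le> log 2 (real (n + 1) * (real (n choose k) * real k ^ k * real (n - k) ^ (n - k)))"
    using binomial_ge_max_term[of k n] assms pos by (intro log_mono) auto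
  also have "\<dots> = log 2 (real n + 1) + log 2 (real (n choose k)) + real k * log 2 (real k)
      + real (n - k) * log 2 (real (n - k))"
    using pos by (simp add: log_mult log_nat_power add_ac)
  finally have *: "real n * log 2 (real n) \<le> \<dots>" .
  have compl: "1 - real k / real n = real (n - k) / real n" using assms by (simp add: field_simps)
  have "real n * binary_entropy (real k / real n)
      = - real k * log 2 (real k / real n) - real (n - k) * log 2 (real (n - k) / real n)"
    unfolding binary_entropy_def compl using pos(3) by (simp add: right_diff_distrib)
  also have "\<dots> = real n * log 2 (real n) - real k * log 2 (real k) - real (n - k) * log 2 (real (n - k))"
    using pos assms by (simp add: log_divide algebra_simps)
  finally show ?thesis using * by linarith
qed

lemma isCont_binary_entropy:
  assumes "0 < x" "x < 1" shows "isCont binary_entropy x"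
  unfolding binary_entropy_def using assms by (intro continuous_intros) auto

text \<open>Makes the exponent H(\<alpha>/2) - \<alpha> positive, so that an error can be expressed
  as a multiple of it.\<close>

lemma binary_entropy_gt:
  assumes "0 < x" "x < 1/2" shows "2 * x < binary_entropy x"
proof (cases "x < 2/5")
  case True
  \<comment> \<open>The bound ln y \<le> y - 1 at y = 4x and y = 1 - x leaves x (2 - 5x), which is
    positive below 2/5.\<close>
  have "x * (1 - 4 * x) + (1 - x) * x \<le> x * - ln (4 * x) + (1 - x) * - ln (1 - x)"
    using assms ln_le_minus_one[of "4 * x"] ln_le_minus_one[of "1 - x"]
    by (intro add_mono mult_left_mono) auto
  moreover have "x * (1 - 4 * x) + (1 - x) * x = x * (2 - 5 * x)" by (simp add: algebra_simps)
  moreover have "x * (2 - 5 * x) > 0" using assms True by simp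
  moreover have "ln (4 * x) = 2 * ln 2 + ln x"
    using assms ln_mult[of 4 x] ln_realpow[of 2 2] by simp
  ultimately have "2 * x * ln 2 < - x * ln x - (1 - x) * ln (1 - x)" by (simp add: algebra_simps)
  hence "2 * x < (- x * ln x - (1 - x) * ln (1 - x)) / ln 2" by (simp add: pos_less_divide_eq)
  also have "\<dots> = binary_entropy x" by (simp add: binary_entropy_def log_def diff_divide_distrib)
  finally show ?thesis .
next
  case False
  \<comment> \<open>On the remaining range \<open>f\<close> decreases to its zero at 1/2: the
    derivative is negative once 1 - t < 4t, that is, t > 1/5.\<close>
  define f where "f t = binary_entropy t - 2 * t" for t
  have "f (1/2) < f x"
  proof (rule DERIV_neg_imp_decreasing[where f = f])
    fix t assume t: "x \<le> t" "t \<le> 1/2"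
    have "((\<lambda>t. - t * ln t - (1 - t) * ln (1 - t)) has_real_derivative ln (1 - t) - ln t) (at t)"
      using t False by (auto intro!: derivative_eq_intros simp: divide_simps)
    hence "((\<lambda>t. (- t * ln t - (1 - t) * ln (1 - t)) / ln 2 - 2 * t) has_real_derivative
        (ln (1 - t) - ln t) / ln 2 - 2 * 1) (at t)"
      by (rule DERIV_diff[OF DERIV_cdivide DERIV_cmult[OF DERIV_ident]])
    moreover have "f = (\<lambda>t. (- t * ln t - (1 - t) * ln (1 - t)) / ln 2 - 2 * t)"
      by (simp add: f_def binary_entropy_def log_def diff_divide_distrib fun_eq_iff)
    ultimately have "(f has_real_derivative (ln (1 - t) - ln t) / ln 2 - 2) (at t)" by simp
    moreover have "(ln (1 - t) - ln t) / ln 2 - 2 < 0"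
    proof -
      have "ln (1 - t) < ln (4 * t)" using t False by simp
      also have "\<dots> = 2 * ln 2 + ln t" using t False assms ln_mult[of 4 t] ln_realpow[of 2 2] by simp
      finally show ?thesis by (simp add: divide_simps)
    qed
    ultimately show "\<exists>y. (f has_real_derivative y) (at t) \<and> y < 0" by blast
  qed (use assms in auto)
  moreover have "f (1/2) = 0" by (simp add: f_def binary_entropy_def log_divide)
  ultimately show ?thesis by (simp add: f_def)
qed

section \<open>Comparison of binomial coefficients and rarity of degenerate sets\<close>

lemma binomial_ratio_le:
  assumes "3 * h \<le> 2 * n"
  shows "3 ^ j * (h choose j) \<le> 2 ^ j * (n choose j :: nat)"
proof (induction j)
  case (Suc j)
  have step: "Suc j * (n choose Suc j) = (n - j) * (n choose j)" for n
    by (metis binomial_absorb_comp binomial_absorption)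
  have scaled: "Suc j * (c ^ Suc j * (n choose Suc j)) = (c * (n - j)) * (c ^ j * (n choose j))" for c n :: nat
  proof -
    have "Suc j * (c ^ Suc j * (n choose Suc j)) = c ^ Suc j * (Suc j * (n choose Suc j))"
      by (simp only: mult_ac)
    also have "\<dots> = (c * (n - j)) * (c ^ j * (n choose j))" by (simp only: step power_Suc mult_ac)
    finally show ?thesis .
  qed
  have "Suc j * (3 ^ Suc j * (h choose Suc j)) = (3 * (h - j)) * (3 ^ j * (h choose j))" by (rule scaled)
  also have "\<dots> \<le> (2 * (n - j)) * (2 ^ j * (n choose j))"
  proof (rule mult_mono[OF _ Suc])
    show "3 * (h - j) \<le> 2 * (n - j)" using assms by arith
  qed simp_all
  also have "\<dots> = Suc j * (2 ^ Suc j * (n choose Suc j))"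
    by (rule scaled[symmetric])
  finally show ?case by (simp only: Suc_mult_le_cancel1)
qed simp

text \<open>Two absorption identities, each losing at most a factor \<open>q\<close>; such
  polynomial losses vanish in the exponent.\<close>

lemma binomial_le_middle:
  assumes "1 \<le> m" "m < q"
  shows "q choose m \<le> q\<^sup>2 * ((q - 2) choose (m - 1))"
proof -
  have "q choose m \<le> m * (q choose m)" using assms by simp
  also have "\<dots> = q * ((q - 1) choose (m - 1))" using assms times_binomial_minus1_eq[of m q] by simp
  also have "\<dots> \<le> q * (q * ((q - 2) choose (m - 1)))"
  proof (rule mult_left_mono)
    have "1 \<le> q - 1 - (m - 1)" using assms by arith
    hence "(q - 1) choose (m - 1) \<le> (q - 1 - (m - 1)) * ((q - 1) choose (m - 1))" by simp
    also have "\<dots> = (q - 1) * ((q - 1 - 1) choose (m - 1))" by (rule binomial_absorb_comp)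
    also have "\<dots> \<le> q * ((q - 2) choose (m - 1))" by (intro mult_mono) (auto simp: numeral_2_eq_2)
    finally show "(q - 1) choose (m - 1) \<le> q * ((q - 2) choose (m - 1))" .
  qed simp
  finally show ?thesis by (simp add: power2_eq_square mult.assoc)
qed

text \<open>Both error terms carry a factor at most (2/3)^(m-2). Raising the lower index from
  \<open>m - 2\<close> to \<open>m - 1\<close> costs \<open>q\<close>, which with the
  \<open>q\<^sup>2\<close> pairs gives q^3 + 1. The factor 2 leaves half of the main term for
  nondegenerate sets.\<close>

lemma degenerate_count_small:
  assumes q: "5 \<le> q" and m: "3 \<le> m" "m < q" and small: "2 * (real q ^ 3 + 1) * (2/3) ^ (m - 2) \<le> 1"
  shows "2 * (real (((q - 1) div 2) choose (m - 1)) + real (q\<^sup>2) * real (((q - 1) div 2) choose (m - 2)))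
     \<le> real ((q - 2) choose (m - 1))"
proof -
  define h n where "h = (q - 1) div 2" and "n = q - 2"
  \<comment> \<open>\<open>h / n\<close> is close to 1/2 for large \<open>q\<close>; for odd
    \<open>q\<close> it is largest at \<open>q = 5\<close>, where it equals 2/3.\<close>
  have hn: "3 * h \<le> 2 * n" using q by (auto simp: h_def n_def)
  have bound: "real (h choose j) \<le> (2/3) ^ j * real (n choose j)" for j
  proof -
    have "real (3 ^ j * (h choose j)) \<le> real (2 ^ j * (n choose j))"
      using binomial_ratio_le[OF hn, of j] by (rule of_nat_mono)
    thus ?thesis by (simp add: power_divide divide_simps mult.commute)
  qed
  have "1 \<le> n - (m - 2)" using m by (simp add: n_def)
  hence "n choose (m - 2) \<le> (n - (m - 2)) * (n choose (m - 2))" by simp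
  also have "\<dots> = (m - 1) * (n choose (m - 1))"
    using binomial_absorb_comp[of n "m - 2"] times_binomial_minus1_eq[of "m - 1" n] m
    by (simp add: numeral_2_eq_2)
  also have "\<dots> \<le> q * (n choose (m - 1))" using m by (intro mult_right_mono) auto
  finally have shift: "real (n choose (m - 2)) \<le> real q * real (n choose (m - 1))"
    by (metis of_nat_mono of_nat_mult)
  let ?c = "(2/3 :: real) ^ (m - 2)" and ?C = "real (n choose (m - 1))"
  have "real (h choose (m - 1)) \<le> ?c * ?C"
    using bound[of "m - 1"] by (rule order_trans) (intro mult_right_mono power_decreasing, auto)
  moreover have "real (q\<^sup>2) * real (h choose (m - 2)) \<le> real (q\<^sup>2) * (?c * (real q * ?C))"
    using bound[of "m - 2"] shift by (intro mult_left_mono order_trans[OF bound]) auto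
  ultimately have "2 * (real (h choose (m - 1)) + real (q\<^sup>2) * real (h choose (m - 2)))
      \<le> 2 * (real q ^ 3 + 1) * ?c * ?C"
    by (simp add: algebra_simps power2_eq_square power3_eq_cube)
  also have "\<dots> \<le> 1 * ?C" using small by (intro mult_right_mono) auto
  finally show ?thesis by (simp add: h_def n_def)
qed

text \<open>Division step of the double count: \<open>g\<close> counts nondegenerate sets,
  \<open>s\<close> homogeneous ones, and \<open>B\<close>, \<open>C\<close>, \<open>P\<close> stand
  for C(q,k), C(q,m), C(q-2,m-1), with Q = q^2 and M = 2^m.\<close>

lemma lower_bound_from_double_count:
  fixes s g B C M P :: real
  assumes "g * B \<le> s * C * M" "P \<le> 2 * g" "C \<le> Q * P" "0 < C" "0 < Q" "0 < M" "0 \<le> B"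
  shows "B / (2 * Q * M) \<le> s"
proof -
  have "Q * P \<le> Q * (2 * g)" using assms(2,5) by (intro mult_left_mono) auto
  hence "C \<le> 2 * Q * g" using assms(3) by linarith
  hence "C * B \<le> 2 * Q * (g * B)" using mult_right_mono[OF _ assms(7)] by fastforce
  also have "\<dots> \<le> 2 * Q * (s * C * M)" using assms(1,5) by (intro mult_left_mono) auto
  finally have "C * B \<le> C * (2 * Q * M * s)" by (simp add: mult_ac)
  hence "B \<le> 2 * Q * M * s" using assms(4) by simp
  thus ?thesis using assms(5,6) by (simp add: divide_le_eq mult_ac)
qed

section \<open>Limits in \<open>q\<close> and the choice of \<open>m\<close>\<close>

lemma eventually_cubic_times_geometric_le:
  fixes \<alpha> :: real assumes "0 < \<alpha>"
  shows "eventually (\<lambda>q::nat. 2 * (real q ^ 3 + 1) * (2/3) powr (\<alpha> * real q - 2) \<le> 1) sequentially"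
proof -
  define c :: real where "c = ln (3/2)"
  define d where "d = c * \<alpha>"
  have "c > 0" by (simp add: c_def)
  hence "d > 0" using assms by (simp add: d_def)
  hence "eventually (\<lambda>q::nat. 2 * (real q ^ 3 + 1) * exp (2 * c - d * real q) \<le> 1) sequentially"
    by real_asymp
  moreover have "(2/3) powr (\<alpha> * real q - 2) = exp (2 * c - d * real q)" for q :: nat
    unfolding powr_def c_def d_def by (simp add: ln_div algebra_simps)
  ultimately show ?thesis by simp
qed

lemma log_cubic_over_tendsto: "(\<lambda>q::nat. log 2 (2 * real q ^ 2 * (real q + 1)) / real q) \<longlonglongrightarrow> 0"
  by real_asymp

text \<open>Odd, so that the larger part of any partition into two strictly exceeds half of \<open>\<alpha> * q\<close>.\<close>

definition odd_ceil :: "real \<Rightarrow> nat \<Rightarrow> nat" where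
  "odd_ceil \<alpha> q = (let N = nat \<lceil>\<alpha> * real q\<rceil> in if even N then N + 1 else N)"

lemma odd_ceil:
  assumes "0 < \<alpha>"
  shows "odd (odd_ceil \<alpha> q)" "\<alpha> * real q \<le> real (odd_ceil \<alpha> q)" "real (odd_ceil \<alpha> q) < \<alpha> * real q + 2"
proof -
  define N where "N = nat \<lceil>\<alpha> * real q\<rceil>"
  have "\<alpha> * real q \<ge> 0" using assms by simp
  hence "real N = of_int \<lceil>\<alpha> * real q\<rceil>" by (simp add: N_def)
  hence "\<alpha> * real q \<le> real N" "real N < \<alpha> * real q + 1" by linarith+
  thus "odd (odd_ceil \<alpha> q)" "\<alpha> * real q \<le> real (odd_ceil \<alpha> q)" "real (odd_ceil \<alpha> q) < \<alpha> * real q + 2"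
    unfolding odd_ceil_def Let_def N_def[symmetric] by auto
qed

lemma odd_ceil_over_tendsto:
  assumes "0 < \<alpha>"
  shows "(\<lambda>q. real (odd_ceil \<alpha> q) / real q) \<longlonglongrightarrow> \<alpha>"
proof (rule tendsto_sandwich)
  show "eventually (\<lambda>q. \<alpha> \<le> real (odd_ceil \<alpha> q) / real q) sequentially"
    using eventually_gt_at_top[of 0]
  proof eventually_elim
    case (elim q)
    thus ?case using odd_ceil(2)[OF assms, of q] by (simp add: field_simps)
  qed
  show "eventually (\<lambda>q. real (odd_ceil \<alpha> q) / real q \<le> \<alpha> + 2 / real q) sequentially"
    using eventually_gt_at_top[of 0]
  proof eventually_elim
    case (elim q)
    thus ?case using odd_ceil(3)[OF assms, of q] by (simp add: field_simps)
  qed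
  show "(\<lambda>q::nat. \<alpha> + 2 / real q) \<longlonglongrightarrow> \<alpha>" by real_asymp
qed simp

section \<open>The lower bound\<close>

lemma (in field_1_mod_4) card_parity_homogeneous_ge_real:
  assumes q: "5 \<le> q" and m: "odd m" "3 \<le> m" "m < q"
    and small: "2 * (real q ^ 3 + 1) * (2/3) ^ (m - 2) \<le> 1"
  shows "real (q choose ((m + 1) div 2)) / (2 * real q ^ 2 * 2 ^ m)
    \<le> real (card {S. S \<subseteq> carrier F \<and> parity_homogeneous nonsq_diff S \<and>
                     m + 1 \<le> 2 * card S \<and> card S + 2 \<le> m})"
    (is "_ \<le> real (card ?S)")
proof -
  let ?T = "{T. T \<subseteq> carrier F \<and> card T = m \<and> \<not> degenerate nonsq_diff T}"
  let ?h = "(q - 1) div 2"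
  have "(q - 2) choose (m - 1) \<le> card ?T + (?h choose (m - 1)) + q\<^sup>2 * (?h choose (m - 2))"
    by (rule card_nondegenerate_subsets[OF fin])
       (use q m card_agree_differ in auto)
  hence "real ((q - 2) choose (m - 1)) \<le> real (card ?T + (?h choose (m - 1)) + q\<^sup>2 * (?h choose (m - 2)))"
    by (rule of_nat_mono)
  hence "real ((q - 2) choose (m - 1)) \<le> real (card ?T) + (real (?h choose (m - 1)) + real (q\<^sup>2) * real (?h choose (m - 2)))"
    by simp
  moreover have "P \<le> 2 * g" if "P \<le> g + x" "2 * x \<le> P" for P g x :: real using that by linarith
  ultimately have 1: "real ((q - 2) choose (m - 1)) \<le> 2 * real (card ?T)"
    using degenerate_count_small[OF q m(2,3) small] by blast
  have "real (card ?T * (q choose ((m + 1) div 2))) \<le> real (card ?S * (q choose m) * 2 ^ m)"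
    using m by (intro of_nat_mono card_parity_homogeneous_ge[OF fin symp_nonsq_diff irreflp_nonsq_diff]) auto
  hence 2: "real (card ?T) * real (q choose ((m + 1) div 2)) \<le> real (card ?S) * real (q choose m) * 2 ^ m"
    by simp
  have "real (q choose m) \<le> real (q\<^sup>2 * ((q - 2) choose (m - 1)))"
    using m by (intro of_nat_mono binomial_le_middle) auto
  hence 3: "real (q choose m) \<le> real q ^ 2 * real ((q - 2) choose (m - 1))" by simp
  show ?thesis by (rule lower_bound_from_double_count[OF 2 1 3]) (use m q in auto)
qed

theorem theorem6p1:
  fixes \<alpha> :: real
  assumes "0 < \<alpha>" and "\<alpha> < 1"
  shows "\<exists>e :: nat \<Rightarrow> real. e \<longlonglongrightarrow> 0 \<and>
    (\<forall>\<^sub>F q in sequentially. primepow q \<and> [q = 1] (mod 4) \<longrightarrow>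
      (\<forall>F :: 'a ring. field F \<and> finite (carrier F) \<and> card (carrier F) = q \<longrightarrow>
        real (card (\<Union>n \<in> {n :: nat. \<alpha> * real q / 2 < real n \<and> real n < \<alpha> * real q}.
                      Omega F n \<union> Omega_ext F (n + 1)))
          \<ge> 2 powr ((1 + e q) * (binary_entropy (\<alpha> / 2) - \<alpha>) * real q)))"
proof -
  define c where "c = binary_entropy (\<alpha> / 2) - \<alpha>"
  have c: "c > 0" using binary_entropy_gt[of "\<alpha> / 2"] assms by (simp add: c_def)
  define m where "m = odd_ceil \<alpha>"
  define k where "k q = (m q + 1) div 2" for q
  note m = odd_ceil[OF assms(1), folded m_def]
  \<comment> \<open>Collects the polynomial losses: 2 q^2 from the double count and q + 1 from the
    entropy bound.\<close>
  define L where "L q = log 2 (2 * real q ^ 2 * (real q + 1))" for q :: nat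
  \<comment> \<open>Solved from (1 + e) c q = q H(k/q) - m - L, so it depends on \<open>q\<close>
    and \<alpha> but not on the field.\<close>
  define e where "e q = (binary_entropy (real (k q) / real q) - real (m q) / real q - L q / real q) / c - 1" for q
  have k2: "real (k q) = (real (m q) + 1) / 2" for q using m(1)[of q] by (auto elim!: oddE simp: k_def)
  have m_lim: "(\<lambda>q. real (m q) / real q) \<longlonglongrightarrow> \<alpha>"
    unfolding m_def by (rule odd_ceil_over_tendsto[OF assms(1)])
  have "(\<lambda>q. (real (m q) / real q) / 2 + 1 / (2 * real q)) \<longlonglongrightarrow> \<alpha> / 2 + 0"
  proof (intro tendsto_add tendsto_divide m_lim tendsto_const)
    show "(\<lambda>q::nat. 1 / (2 * real q)) \<longlonglongrightarrow> 0" by real_asymp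
  qed simp
  hence "(\<lambda>q. real (k q) / real q) \<longlonglongrightarrow> \<alpha> / 2" unfolding k2 by (simp add: add_divide_distrib mult.commute)
  hence "(\<lambda>q. binary_entropy (real (k q) / real q)) \<longlonglongrightarrow> binary_entropy (\<alpha> / 2)"
    by (rule isCont_tendsto_compose[rotated]) (use assms in \<open>auto intro: isCont_binary_entropy\<close>)
  hence "(\<lambda>q. binary_entropy (real (k q) / real q) - real (m q) / real q - L q / real q)
      \<longlonglongrightarrow> binary_entropy (\<alpha> / 2) - \<alpha> - 0"
    unfolding L_def by (intro tendsto_diff m_lim log_cubic_over_tendsto)
  hence "e \<longlonglongrightarrow> (binary_entropy (\<alpha> / 2) - \<alpha> - 0) / c - 1"
    unfolding e_def using c by (intro tendsto_diff[OF tendsto_divide[OF _ tendsto_const] tendsto_const]) auto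
  hence e_lim: "e \<longlonglongrightarrow> 0" using c by (simp add: c_def)
  \<comment> \<open>These bounds yield \<open>3 \<le> m q\<close> and \<open>m q < q\<close>, the
    latter because \<open>m q\<close> stays below \<alpha> q + 2.\<close>
  have "eventually (\<lambda>q::nat. 3 \<le> \<alpha> * real q) sequentially" using assms by real_asymp
  moreover have "eventually (\<lambda>q::nat. \<alpha> * real q + 2 \<le> real q) sequentially" using assms by real_asymp
  ultimately have "\<forall>\<^sub>F q in sequentially. primepow q \<and> [q = 1] (mod 4) \<longrightarrow>
      (\<forall>F :: 'a ring. field F \<and> finite (carrier F) \<and> card (carrier F) = q \<longrightarrow>
        real (card (\<Union>n \<in> {n :: nat. \<alpha> * real q / 2 < real n \<and> real n < \<alpha> * real q}.
                      Omega F n \<union> Omega_ext F (n + 1)))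
          \<ge> 2 powr ((1 + e q) * (binary_entropy (\<alpha> / 2) - \<alpha>) * real q))"
    using eventually_cubic_times_geometric_le[OF assms(1)] eventually_ge_at_top[of 5]
  proof eventually_elim
    case (elim q)
    show ?case
    proof (intro impI allI)
      fix F :: "'a ring"
      assume q: "primepow q \<and> [q = 1] (mod 4)" and F: "field F \<and> finite (carrier F) \<and> card (carrier F) = q"
      interpret field_1_mod_4 F
        by (unfold field_1_mod_4_def field_1_mod_4_axioms_def) (use q F in \<open>simp add: Cong.cong_def\<close>)
      have qF: "card (carrier F) = q" using F by simp
      have mq: "3 \<le> m q" "m q < q" using elim m(2,3)[of q] by linarith+
      have "(2/3 :: real) ^ (m q - 2) = (2/3) powr real (m q - 2)" by (simp add: powr_realpow)
      also have "\<dots> \<le> (2/3) powr (\<alpha> * real q - 2)" using m(2)[of q] mq by (intro powr_mono') auto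
      finally have "2 * (real q ^ 3 + 1) * (2/3) ^ (m q - 2) \<le> 2 * (real q ^ 3 + 1) * (2/3) powr (\<alpha> * real q - 2)"
        by (intro mult_left_mono) auto
      hence small: "2 * (real q ^ 3 + 1) * (2/3) ^ (m q - 2) \<le> 1" using elim by linarith
      define \<S> where "\<S> = {S. S \<subseteq> carrier F \<and> parity_homogeneous nonsq_diff S \<and>
                     m q + 1 \<le> 2 * card S \<and> card S + 2 \<le> m q}"
      define \<U> where "\<U> = (\<Union>n \<in> {n :: nat. \<alpha> * real q / 2 < real n \<and> real n < \<alpha> * real q}.
                      Omega F n \<union> Omega_ext F (n + 1))"
      have lower: "real (q choose k q) / (2 * real q ^ 2 * 2 ^ m q) \<le> real (card \<S>)"
        using card_parity_homogeneous_ge_real[of "m q"] m(1) mq small elim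
        unfolding \<S>_def k_def qF by blast
      \<comment> \<open>Both strict inequalities come from the choice of \<open>m\<close>: 2
        \<open>card S\<close> \<ge> m + 1 > \<alpha> q and \<open>card S\<close> \<le> m - 2 <
        \<alpha> q.\<close>
      have "\<S> \<subseteq> \<U>"
      proof
        fix S assume S: "S \<in> \<S>"
        hence "real (m q + 1) \<le> real (2 * card S)" "real (card S + 2) \<le> real (m q)"
          unfolding \<S>_def by (auto simp del: of_nat_add of_nat_mult)
        hence "\<alpha> * real q / 2 < real (card S)" "real (card S) < \<alpha> * real q"
          using m(2,3)[of q] by simp_all
        moreover have "S \<in> Omega F (card S) \<union> Omega_ext F (card S + 1)"
          using S by (intro parity_homogeneous_imp_Omega) (auto simp: \<S>_def)
        ultimately show "S \<in> \<U>" unfolding \<U>_def by blast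
      qed
      moreover have "\<U> \<subseteq> Pow (carrier F)" by (auto simp: \<U>_def Omega_def Omega_ext_def)
      hence "finite \<U>" using fin finite_subset by blast
      ultimately have "card \<S> \<le> card \<U>" by (intro card_mono)
      hence "real (card \<S>) \<le> real (card \<U>)" by simp
      with lower have low: "real (q choose k q) / (2 * real q ^ 2 * 2 ^ m q) \<le> real (card \<U>)"
        by (rule order_trans)
      have q0: "real q > 0" using elim by simp
      have kq: "0 < k q" "k q < q" using mq by (auto simp: k_def)
      hence C0: "real (q choose k q) > 0" by simp
      have "(1 + e q) * c * real q
          = real q * binary_entropy (real (k q) / real q) - real (m q) - L q"
        unfolding e_def using c q0 by (simp add: field_simps)
      also have "\<dots> = (real q * binary_entropy (real (k q) / real q) - log 2 (real q + 1))
          - real (m q) - log 2 (2 * real q ^ 2)"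
        unfolding L_def using q0 by (subst log_mult) auto
      also have "\<dots> \<le> log 2 (real (q choose k q)) - real (m q) - log 2 (2 * real q ^ 2)"
        using log_binomial_ge_entropy[OF kq] by simp
      also have "\<dots> = log 2 (real (q choose k q) / (2 * real q ^ 2 * 2 ^ m q))"
        using q0 C0 by (simp add: log_divide log_mult log_nat_power)
      finally have "2 powr ((1 + e q) * c * real q)
          \<le> 2 powr log 2 (real (q choose k q) / (2 * real q ^ 2 * 2 ^ m q))" by simp
      also have "\<dots> = real (q choose k q) / (2 * real q ^ 2 * 2 ^ m q)" using q0 C0 by simp
      finally show "2 powr ((1 + e q) * (binary_entropy (\<alpha> / 2) - \<alpha>) * real q)
          \<le> real (card (\<Union>n \<in> {n :: nat. \<alpha> * real q / 2 < real n \<and> real n < \<alpha> * real q}.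
                      Omega F n \<union> Omega_ext F (n + 1)))"
        using low unfolding \<U>_def c_def by linarith
    qed
  qed
  thus ?thesis using e_lim by blast
qed

end
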